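(* Let $p\ge2$ and let $k\ge1$ be an integer. Define $\Sigma\subseteq\Lambda^{(p)}$ as follows: for $n\in\mathbb{N}$ and $s,t\in B_n^{(p)}$ with insertion tuples $\mathbf{u}=\mathrm{IT}(s)$ and $\mathbf{v}=\mathrm{IT}(t)$, $$(s,t)\in\Sigma\iff\begin{cases}s=t,&\text{if } n<k;\\ u_i=v_i\text{ for all } i\in\{n-k+1,\ldots,n\},&\text{if } n\ge k.\end{cases}$$ Then $\Sigma$ is an equivalence relation that is closed under the implication operator; therefore there exists a $p$-ary groupoid $\mathbf{A}$ such that $\sigma(\mathbf{A})=\Sigma$. The associative spectrum of $\mathbf{A}$ is $$s_n(\mathbf{A})=\begin{cases}C_n^{(p)},&\text{if } n<k;\\[1ex] \dfrac{(p-1)(n-k)+1}{(p-1)n+1}\dbinom{(p-1)n+k}{k},&\text{if } n\ge k.\end{cases}$$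
   Context: $\mathbb{N}$ includes $0$; $p\ge 2$ is an integer. $T$ is the set of $p$-ary bracketings: terms (prefix notation) over the single variable $x$ and the $p$-ary operation symbol $\omega$, i.e. $x\in T$, and $\omega t_1\ldots t_p\in T$ whenever $t_1,\ldots,t_p\in T$. $|t|_\omega$ is the number of occurrences of $\omega$ and $|t|=(p-1)|t|_\omega+1$ the number of occurrences of $x$ in $t$. $B_n^{(p)}=\{t\in T:|t|_\omega=n\}$, $\Lambda^{(p)}=\{(s,t)\in T\times T:|s|_\omega=|t|_\omega\}$, and $\Sigma_n=\Sigma\cap(B_n^{(p)}\times B_n^{(p)})$. The insertion tuple $\mathrm{IT}(t)$ is the tuple of length $|t|_\omega$ whose $i$-th entry is one plus the number of $x$'s preceding the $i$-th symbol $\omega$ in the prefix notation of $t$. The generalized Catalan numbers are defined by $C_0^{(p)}=1$ and, for $n\ge 1$, $C_n^{(p)}=\sum\prod_{l=1}^pC_{i_l}^{(p)}$, the sum being over all $(i_1,\ldots,i_p)\in\mathbb{N}^p$ with $i_1+\cdots+i_p=n-1$; one has $|B_n^{(p)}|=C_n^{(p)}$. $\gamma_i(t)=\omega x\ldots x\,t\,x\ldots x$ with $t$ as the $i$-th argument and $x$ as all the others ($1\le i\le p$). $\beta_i(t)$ is obtained from $t$ by replacing the $i$-th occurrence (from the left) of $x$ in $t$ by $\omega x\ldots x$. For an equivalence relation $\pi$ on $B_n^{(p)}$, $\delta_n(\pi)$ is the equivalence relation on $B_{n+1}^{(p)}$ that is the transitive closure of $\bigcup_\xi\{(\xi(s),\xi(t)):(s,t)\in\pi\}$,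 where $\xi$ ranges over $\gamma_1,\ldots,\gamma_p,\beta_1,\ldots,\beta_{(p-1)n+1}$. "$\Sigma$ is closed under the implication operator" means $\delta_n(\Sigma_n)\subseteq\Sigma_{n+1}$ for all $n\in\mathbb{N}$. A $p$-ary groupoid is an algebra with one $p$-ary operation. $\varepsilon_1(t)$ is the term obtained from $t$ by replacing the occurrences of $x$, from left to right, by distinct variables $x_1,x_2,\ldots$. The fine spectrum $\sigma(\mathbf{A})$ is the set of all $(s,t)\in\Lambda^{(p)}$ such that $\mathbf{A}$ satisfies the identity $\varepsilon_1(s)\approx\varepsilon_1(t)$; $\sigma_n(\mathbf{A})$ is its restriction to $B_n^{(p)}$; the associative spectrum is $s_n(\mathbf{A})=|B_n^{(p)}/\sigma_n(\mathbf{A})|$. *)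

theory Defs
  imports Complex_Main
begin

section \<open>Terms and bracketings\<close>

datatype 'v trm = Var 'v | Om "'v trm list"

datatype 'v symbol = VarS 'v | OmS

primrec prefix :: "'v trm \<Rightarrow> 'v symbol list" where
  "prefix (Var v) = [VarS v]"
| "prefix (Om ts) = OmS # concat (map prefix ts)"

primrec subst :: "('v \<Rightarrow> 'w trm) \<Rightarrow> 'v trm \<Rightarrow> 'w trm" where
  "subst \<theta> (Var v) = \<theta> v"
| "subst \<theta> (Om ts) = Om (map (subst \<theta>) ts)"

text \<open>Terms over a single variable are terms over the one-element type \<^typ>\<open>unit\<close>.\<close>

abbreviation vx :: "unit trm" where
  "vx \<equiv> Var ()"

inductive_set bracketings :: "nat \<Rightarrow> unit trm set" for p :: nat where
  "vx \<in> bracketings p"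
| "\<lbrakk>length ts = p; \<forall>t\<in>set ts. t \<in> bracketings p\<rbrakk> \<Longrightarrow> Om ts \<in> bracketings p"

definition om_count :: "'v trm \<Rightarrow> nat" where
  "om_count t = count_list (prefix t) OmS"

definition B :: "nat \<Rightarrow> nat \<Rightarrow> unit trm set" where
  "B p n = {t \<in> bracketings p. om_count t = n}"

definition Lam :: "nat \<Rightarrow> (unit trm \<times> unit trm) set" where
  "Lam p = {(s, t). s \<in> bracketings p \<and> t \<in> bracketings p \<and> om_count s = om_count t}"

definition level :: "nat \<Rightarrow> nat \<Rightarrow> (unit trm \<times> unit trm) set \<Rightarrow> (unit trm \<times> unit trm) set" where
  "level p n R = R \<inter> (B p n \<times> B p n)"

definition IT :: "unit trm \<Rightarrow> nat list" where
  "IT t = map (\<lambda>j. 1 + count_list (take j (prefix t)) (VarS ()))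
            (filter (\<lambda>j. prefix t ! j = OmS) [0..<length (prefix t)])"

section \<open>Generalized Catalan numbers\<close>

text \<open>Tuples in \<open>\<nat>\<^sup>p\<close> are lists of length \<open>p\<close>.\<close>

function gen_catalan :: "nat \<Rightarrow> nat \<Rightarrow> nat" where
  "gen_catalan p 0 = 1"
| "gen_catalan p (Suc n) =
     (\<Sum>is\<in>{is. length is = p \<and> sum_list is = n}. prod_list (map (gen_catalan p) is))"
  by pat_completeness auto
termination
  by (relation "measure snd") (auto simp: less_Suc_eq_le intro: member_le_sum_list)

section \<open>The implication operator\<close>

text \<open>\<open>label m t\<close> replaces the occurrences of variables in \<open>t\<close>, from left to right, by
  the variables with numbers \<open>m, m + 1, \<dots>\<close>.\<close>

fun label :: "nat \<Rightarrow> 'v trm \<Rightarrow> nat trm" and labels :: "nat \<Rightarrow> 'v trm list \<Rightarrow> nat trm list" where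
  "label m (Var v) = Var m"
| "label m (Om ts) = Om (labels m ts)"
| "labels m [] = []"
| "labels m (t # ts) =
     label m t # labels (m + length (filter (\<lambda>a. a \<noteq> OmS) (prefix t))) ts"

definition eps1 :: "unit trm \<Rightarrow> nat trm" where
  "eps1 t = label 1 t"

definition gam :: "nat \<Rightarrow> nat \<Rightarrow> unit trm \<Rightarrow> unit trm" where
  "gam p i t = Om ((replicate p vx)[i - 1 := t])"

text \<open>In \<open>eps1 t\<close> the variable number \<open>i\<close> marks the \<open>i\<close>-th occurrence of \<open>vx\<close> in \<open>t\<close>.\<close>

definition bet :: "nat \<Rightarrow> nat \<Rightarrow> unit trm \<Rightarrow> unit trm" where
  "bet p i t = subst (\<lambda>j. if j = i then Om (replicate p vx) else vx) (eps1 t)"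

definition impl_op :: "nat \<Rightarrow> nat \<Rightarrow> (unit trm \<times> unit trm) set \<Rightarrow> (unit trm \<times> unit trm) set" where
  "impl_op p n \<pi> =
     (\<Union>\<xi> \<in> gam p ` {1..p} \<union> bet p ` {1..(p - 1) * n + 1}. {(\<xi> s, \<xi> t) | s t. (s, t) \<in> \<pi>})\<^sup>+"

definition closed_under_impl :: "nat \<Rightarrow> (unit trm \<times> unit trm) set \<Rightarrow> bool" where
  "closed_under_impl p R \<longleftrightarrow> (\<forall>n. impl_op p n (level p n R) \<subseteq> level p (n + 1) R)"

section \<open>Groupoids and their spectra\<close>

text \<open>The operation is only relevant on lists of length \<open>p\<close> over the carrier; its values on other
  lists are arbitrary and never enter the evaluation of a \<open>p\<close>-ary term.\<close>

definition p_groupoid :: "nat \<Rightarrow> 'a set \<Rightarrow> ('a list \<Rightarrow> 'a) \<Rightarrow> bool" where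
  "p_groupoid p A f \<longleftrightarrow>
     A \<noteq> {} \<and> (\<forall>as. length as = p \<and> set as \<subseteq> A \<longrightarrow> f as \<in> A)"

primrec eval_trm :: "('a list \<Rightarrow> 'a) \<Rightarrow> ('v \<Rightarrow> 'a) \<Rightarrow> 'v trm \<Rightarrow> 'a" where
  "eval_trm f h (Var v) = h v"
| "eval_trm f h (Om ts) = f (map (eval_trm f h) ts)"

definition satisfies :: "'a set \<Rightarrow> ('a list \<Rightarrow> 'a) \<Rightarrow> 'v trm \<Rightarrow> 'v trm \<Rightarrow> bool" where
  "satisfies A f s t \<longleftrightarrow> (\<forall>h. (\<forall>v. h v \<in> A) \<longrightarrow> eval_trm f h s = eval_trm f h t)"

definition fine_spectrum :: "nat \<Rightarrow> 'a set \<Rightarrow> ('a list \<Rightarrow> 'a) \<Rightarrow> (unit trm \<times> unit trm) set" where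
  "fine_spectrum p A f = {(s, t) \<in> Lam p. satisfies A f (eps1 s) (eps1 t)}"

definition assoc_spectrum :: "nat \<Rightarrow> 'a set \<Rightarrow> ('a list \<Rightarrow> 'a) \<Rightarrow> nat \<Rightarrow> nat" where
  "assoc_spectrum p A f n = card (B p n // level p n (fine_spectrum p A f))"

section \<open>Agreement of the last \<open>k\<close> entries of the insertion tuple\<close>

text \<open>Insertion tuples are indexed from 1, lists from 0.\<close>

definition Sig :: "nat \<Rightarrow> nat \<Rightarrow> (unit trm \<times> unit trm) set" where
  "Sig p k = {(s, t). \<exists>n. s \<in> B p n \<and> t \<in> B p n \<and>
     (if n < k then s = t
      else \<forall>i\<in>{n - k + 1..n}. IT s ! (i - 1) = IT t ! (i - 1))}"

end

(* Two bracketings of the same size are related by Sig iff their prefix words agree after all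
   but the last k occurrences of the operation symbol are deleted. Deleting is compatible with
   concatenation and with substitution of words for variables, so Sig is closed under the
   implication operator, and the words with at most k operation symbols form a groupoid under
   (a_1, ..., a_p) |-> trim (omega a_1 ... a_p) whose fine spectrum is Sig. For n >= k, the
   trimmed words are exactly those with k operation symbols and (p - 1) n + 1 variables in which
   every nonempty suffix has more than p - 1 times as many variables as operation symbols;
   splitting off the first letter gives the ballot recursion for their number. *)

theory Submission
  imports Defs "HOL-Library.Countable"
begin

section \<open>Trimming words\<close>

instance symbol :: (countable) countable
  by countable_datatype

abbreviation oms :: "'v symbol list \<Rightarrow> nat" where
  "oms w \<equiv> count_list w OmS"

abbreviation vars :: "'v symbol list \<Rightarrow> nat" where
  "vars w \<equiv> length (filter (\<lambda>a. a \<noteq> OmS) w)"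

lemma oms_replicate [simp]:
  "oms (replicate j OmS) = j"
  "oms (replicate j (VarS v)) = 0"
  by (induction j) auto

text \<open>An \<open>OmS\<close> is dropped exactly when at least k others stand to its right, so
  the last k survive together with all variables.\<close>

fun trim :: "nat \<Rightarrow> 'v symbol list \<Rightarrow> 'v symbol list" where
  "trim k [] = []"
| "trim k (a # w) = (if a = OmS \<and> k \<le> oms w then trim k w else a # trim k w)"

lemma oms_trim: "oms (trim k w) = min k (oms w)"
  by (induction w) auto

lemma vars_trim: "vars (trim k w) = vars w"
  by (induction w) auto

lemma trim_ident: "oms w \<le> k \<Longrightarrow> trim k w = w"
  by (induction w) auto

text \<open>The symbols of \<open>v\<close> use up the budget k first; truncated subtraction leaves
  0 for \<open>u\<close> once \<open>v\<close> has k of them.\<close>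

lemma trim_append: "trim k (u @ v) = trim (k - oms v) u @ trim k v"
  by (induction u) auto

lemma trim_trim: "trim j (trim k w) = trim (min j k) w"
  by (induction w) (auto simp: oms_trim)

text \<open>The trims of \<open>v\<close> and \<open>v'\<close> determine only \<open>min k\<close>
  of their counts, but that already fixes the budget \<open>k - oms v\<close> left for the first
  factor. Trimming by this smaller budget factors through \<open>trim k\<close>.\<close>

lemma trim_append_cong:
  assumes "trim k u = trim k u'" and "trim k v = trim k v'"
  shows "trim k (u @ v) = trim k (u' @ v')"
proof -
  have "min k (oms v) = min k (oms v')"
    using assms(2) oms_trim by metis
  then have j: "k - oms v = k - oms v'"
    by linarith
  have "trim (k - oms v) u = trim (k - oms v) (trim k u)"
    by (simp add: trim_trim min_def)
  also have "\<dots> = trim (k - oms v) u'"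
    by (simp add: assms(1) trim_trim min_def)
  finally show ?thesis
    using assms(2) j by (simp add: trim_append)
qed

lemma trim_concat_cong:
  assumes "\<forall>t\<in>set ts. trim k (g t) = trim k (g' t)"
  shows "trim k (concat (map g ts)) = trim k (concat (map g' ts))"
  using assms by (induction ts) (auto intro: trim_append_cong)

section \<open>Substitution of words for variables, the prefix-word form of
  \<open>subst\<close>\<close>

definition word_subst :: "('v \<Rightarrow> 'w symbol list) \<Rightarrow> 'v symbol list \<Rightarrow> 'w symbol list" where
  "word_subst \<phi> w = concat (map (\<lambda>a. case a of VarS v \<Rightarrow> \<phi> v | OmS \<Rightarrow> [OmS]) w)"

lemma word_subst_simps [simp]:
  "word_subst \<phi> [] = []"
  "word_subst \<phi> (OmS # w) = OmS # word_subst \<phi> w"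
  "word_subst \<phi> (VarS v # w) = \<phi> v @ word_subst \<phi> w"
  "word_subst \<phi> (u @ w) = word_subst \<phi> u @ word_subst \<phi> w"
  by (simp_all add: word_subst_def)

lemma word_subst_concat: "word_subst \<phi> (concat ws) = concat (map (word_subst \<phi>) ws)"
  by (induction ws) auto

lemma oms_word_subst: "oms w \<le> oms (word_subst \<phi> w)"
proof (induction w)
  case (Cons a w)
  then show ?case by (cases a) auto
qed simp

text \<open>A symbol deleted by the inner \<open>trim\<close> has k others to its right.
  Substitution removes none of these, so the outer \<open>trim\<close> would delete it
  anyway.\<close>

lemma trim_word_subst: "trim k (word_subst \<phi> (trim k w)) = trim k (word_subst \<phi> w)"
proof (induction w)
  case (Cons a w)
  show ?case
  proof (cases a)
    case (VarS v)
    then show ?thesis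
      using Cons trim_append_cong by fastforce
  next
    case OmS
    show ?thesis
    proof (cases "k \<le> oms w")
      case True
      then have "k \<le> oms (word_subst \<phi> w)"
        using oms_word_subst le_trans by blast
      then show ?thesis
        using OmS Cons True by simp
    next
      case False
      then show ?thesis
        using OmS trim_append_cong[OF refl Cons, of "[OmS]"] by (simp split del: if_split)
    qed
  qed
qed simp

fun relabel :: "nat \<Rightarrow> 'v symbol list \<Rightarrow> nat symbol list" where
  "relabel m [] = []"
| "relabel m (OmS # w) = OmS # relabel m w"
| "relabel m (VarS v # w) = VarS m # relabel (Suc m) w"

lemma oms_relabel [simp]: "oms (relabel m w) = oms w"
  by (induction m w rule: relabel.induct) auto

text \<open>A variable's number depends only on the variables before it, and trimming deletes none
  of them.\<close>

lemma trim_relabel: "trim k (relabel m w) = relabel m (trim k w)"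
  by (induction m w rule: relabel.induct) auto

lemma relabel_append: "relabel m (u @ v) = relabel m u @ relabel (m + vars u) v"
  by (induction m u rule: relabel.induct) auto

lemma prefix_label:
  "prefix (label m t) = relabel m (prefix t)"
  "concat (map prefix (labels m ts)) = relabel m (concat (map prefix ts))"
  for t :: "'v trm" and ts :: "'v trm list"
  by (induction m t and m ts rule: label_labels.induct) (auto simp: relabel_append)

lemma prefix_subst: "prefix (subst \<theta> t) = word_subst (prefix \<circ> \<theta>) (prefix t)"
  by (induction t) (auto simp: word_subst_concat o_def intro!: arg_cong[of _ _ concat])

text \<open>Used twice: with the substitution that defines \<open>bet\<close>, and with the
  assignment of words to variables when terms are evaluated in the groupoid.\<close>

lemma trim_subst_eps1_cong:
  assumes "trim k (prefix s) = trim k (prefix t)"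
  shows "trim k (word_subst \<phi> (prefix (eps1 s))) = trim k (word_subst \<phi> (prefix (eps1 t)))"
proof -
  have "trim k (word_subst \<phi> (prefix (eps1 s))) =
      trim k (word_subst \<phi> (relabel 1 (trim k (prefix s))))" for s
    by (metis eps1_def prefix_label(1) trim_relabel trim_word_subst)
  then show ?thesis
    using assms by metis
qed

section \<open>Prefix words of bracketings\<close>

lemma oms_vars_prefix:
  assumes "t \<in> bracketings p" and "p \<ge> 1"
  shows "vars (prefix t) = (p - 1) * oms (prefix t) + 1"
  using assms
proof (induction rule: bracketings.induct)
  case (2 ts)
  have "vars (concat (map prefix ts)) = (p - 1) * oms (concat (map prefix ts)) + length ts"
    using 2(2,3) by (induction ts) (auto simp: add_mult_distrib2)
  then show ?case
    using 2(1,3) by (simp add: add_mult_distrib2)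
qed simp

text \<open>Evaluation from the right with a stack of terms: \<open>OmS\<close> pops p terms and
  pushes the compound term. If fewer than p are available, the term built is no bracketing.\<close>

fun parse :: "nat \<Rightarrow> unit symbol list \<Rightarrow> unit trm list" where
  "parse p [] = []"
| "parse p (VarS v # w) = vx # parse p w"
| "parse p (OmS # w) = Om (take p (parse p w)) # drop p (parse p w)"

text \<open>The trailing word \<open>w\<close> is what the induction over argument lists needs; with
  \<open>w\<close> empty this yields unique readability.\<close>

lemma parse_prefix:
  assumes "t \<in> bracketings p"
  shows "parse p (prefix t @ w) = t # parse p w"
  using assms
proof (induction arbitrary: w rule: bracketings.induct)
  case (2 ts)
  have "parse p (concat (map prefix ts) @ w) = ts @ parse p w"
    using 2(2) by (induction ts) auto
  then show ?case
    using 2 by simp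
qed simp

lemma inj_on_prefix: "inj_on prefix (bracketings p)"
proof
  fix s t assume "s \<in> bracketings p" "t \<in> bracketings p" "prefix s = prefix t"
  then show "s = t"
    using parse_prefix[of s p "[]"] parse_prefix[of t p "[]"] by simp
qed

text \<open>The condition of Lukasiewicz words, imposed on all nonempty suffixes.\<close>

fun good :: "nat \<Rightarrow> 'v symbol list \<Rightarrow> bool" where
  "good q [] = True"
| "good q (a # w) \<longleftrightarrow> good q w \<and> q * oms (a # w) < vars (a # w)"

text \<open>A suffix reaching into \<open>u\<close> is a nonempty suffix of \<open>u\<close>
  followed by all of \<open>v\<close>. The strict inequality of the former adds to a weak one for
  \<open>v\<close>, weak because \<open>v\<close> may be empty.\<close>

lemma good_append:
  assumes "good q u" and "good q v"
  shows "good q (u @ v)"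
proof -
  have "q * oms v \<le> vars v"
    using assms(2) by (cases v) auto
  then show ?thesis
    using assms by (induction u) (auto simp: algebra_simps)
qed

lemma good_prefix:
  assumes "t \<in> bracketings p" and "p \<ge> 1"
  shows "good (p - 1) (prefix t)"
  using assms
proof (induction rule: bracketings.induct)
  case (2 ts)
  have "good (p - 1) (concat (map prefix ts))"
    using 2(2,3) by (induction ts) (auto intro: good_append)
  moreover have "Om ts \<in> bracketings p"
    using 2 by (intro bracketings.intros) auto
  ultimately show ?case
    using oms_vars_prefix[of "Om ts" p] 2 by (simp add: algebra_simps)
qed simp

text \<open>The third conjunct is the invariant: the stack height is the surplus of variables over
  (p - 1) times the operation symbols.\<close>

lemma good_parse:
  assumes "good (p - 1) w" and "p \<ge> 1"
  shows "concat (map prefix (parse p w)) = w \<and> set (parse p w) \<subseteq> bracketings p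
    \<and> vars w = (p - 1) * oms w + length (parse p w)"
  using assms
proof (induction p w rule: parse.induct)
  case (2 p v w)
  then show ?case
    by (auto intro: bracketings.intros)
next
  case (3 p w)
  then have IH: "concat (map prefix (parse p w)) = w" "set (parse p w) \<subseteq> bracketings p"
    "vars w = (p - 1) * oms w + length (parse p w)"
    by auto
  obtain q where q: "p = Suc q"
    using "3.prems" by (cases p) auto
  \<comment> \<open>The strict inequality for \<open>OmS # w\<close> makes the surplus of
    \<open>w\<close> exceed p - 1, so p arguments are available.\<close>
  have l: "p \<le> length (parse p w)"
    using "3.prems" IH(3) unfolding q by simp
  have "concat (map prefix (take p (parse p w))) @ concat (map prefix (drop p (parse p w))) = w"
    by (metis IH(1) append_take_drop_id concat_append map_append)
  moreover have "Om (take p (parse p w)) \<in> bracketings p"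
    using l IH(2) by (intro bracketings.intros) (auto dest: in_set_takeD)
  moreover have "set (drop p (parse p w)) \<subseteq> bracketings p"
    using IH(2) set_drop_subset by fast
  moreover have "(p - 1) * oms w + length (parse p w) =
      (p - 1) * Suc (oms w) + Suc (length (parse p w) - p)"
    using l unfolding q by simp
  ultimately show ?case
    using IH(3) by simp
qed simp

lemma good_imp_prefix:
  assumes "good (p - 1) w" and "p \<ge> 1" and "vars w = (p - 1) * oms w + 1"
  obtains t where "t \<in> bracketings p" and "prefix t = w"
proof -
  have "length (parse p w) = 1"
    using good_parse[OF assms(1,2)] assms(3) by simp
  then obtain t where "parse p w = [t]"
    by (metis One_nat_def length_0_conv length_Suc_conv)
  then show ?thesis
    using good_parse[OF assms(1,2)] that by auto
qed

section \<open>The words that arise by trimming bracketings\<close>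

lemma good_trim: "good q w \<Longrightarrow> good q (trim k w)"
proof (induction w)
  case (Cons a w)
  \<comment> \<open>Deleting operation symbols lowers only the left-hand side of the suffix
    condition.\<close>
  have "q * oms (trim k (a # w)) \<le> q * oms (a # w)"
    unfolding oms_trim by (intro mult_left_mono) auto
  also have "\<dots> < vars (trim k (a # w))"
    unfolding vars_trim using Cons.prems by (simp only: good.simps)
  finally have "q * oms (trim k (a # w)) < vars (trim k (a # w))" .
  then show ?case
    using Cons by (auto split: if_splits)
qed simp

text \<open>Only the longest suffix has to be checked: those with fewer added symbols satisfy the
  inequality a fortiori.\<close>

lemma good_replicate_append:
  assumes "good q w" and "q * (j + oms w) < vars w"
  shows "good q (replicate j OmS @ w)"
  using assms by (induction j) auto

lemma trim_replicate_append:
  "oms w = k \<Longrightarrow> trim k (replicate j OmS @ w) = w"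
  by (induction j) (auto simp: trim_ident)

lemma trim_prefix_image:
  assumes "p \<ge> 1" and "k \<le> n"
  shows "(\<lambda>t. trim k (prefix t)) ` B p n =
    {w. good (p - 1) w \<and> oms w = k \<and> vars w = (p - 1) * n + 1}" (is "?L = ?R")
proof
  show "?L \<subseteq> ?R"
    using assms good_trim[OF good_prefix[OF _ assms(1)]]
    by (auto simp: B_def om_count_def oms_trim vars_trim oms_vars_prefix)
  show "?R \<subseteq> ?L"
  proof
    fix w assume w: "w \<in> ?R"
    \<comment> \<open>A preimage: the missing symbols go to the front, where trimming removes
      exactly them.\<close>
    let ?w = "replicate (n - k) OmS @ w"
    have o: "oms ?w = n"
      using w assms(2) by simp
    have v: "vars ?w = (p - 1) * n + 1"
      using w by simp
    have "good (p - 1) ?w"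
      using w assms by (intro good_replicate_append) auto
    then obtain t where t: "t \<in> bracketings p" "prefix t = ?w"
      using good_imp_prefix[of p ?w] o v assms(1) by metis
    moreover have "t \<in> B p n"
      using t o by (simp add: B_def om_count_def)
    moreover have "trim k (prefix t) = w"
      using t w by (simp add: trim_replicate_append)
    ultimately show "w \<in> ?L"
      by blast
  qed
qed

section \<open>Insertion tuples\<close>

text \<open>The insertion tuple by recursion on the word; the accumulator m is one plus the number
  of variables already read, hence the start at 1 below.\<close>

fun positions :: "nat \<Rightarrow> 'v symbol list \<Rightarrow> nat list" where
  "positions m [] = []"
| "positions m (OmS # w) = m # positions m w"
| "positions m (VarS v # w) = positions (Suc m) w"

lemma IT_positions: "IT t = positions 1 (prefix t)"
proof -
  have "map (\<lambda>j. m + count_list (take j w) (VarS ())) (filter (\<lambda>j. w ! j = OmS) [0..<length w])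
      = positions m w" for m w
  proof (induction m w rule: positions.induct)
    case (2 m w)
    have "[0..<length (OmS # w)] = 0 # map Suc [0..<length w]"
      by (simp add: upt_conv_Cons map_Suc_upt del: upt_Suc)
    then show ?case
      using 2 by (simp add: filter_map o_def del: upt_Suc)
  next
    case (3 m v w)
    have "[0..<length (VarS v # w)] = 0 # map Suc [0..<length w]"
      by (simp add: upt_conv_Cons map_Suc_upt del: upt_Suc)
    then show ?case
      using 3 by (simp add: filter_map o_def del: upt_Suc)
  qed simp
  from this[of 1 "prefix t"] show ?thesis
    unfolding IT_def .
qed

lemma length_positions [simp]: "length (positions m w) = oms w"
  by (induction m w rule: positions.induct) auto

lemma positions_ge: "x \<in> set (positions m w) \<Longrightarrow> m \<le> x"
  by (induction m w rule: positions.induct) auto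

text \<open>Deleted symbols are not variables, so the surviving entries keep their values and only
  initial entries disappear.\<close>

lemma positions_trim: "positions m (trim k w) = drop (oms w - k) (positions m w)"
  by (induction m w rule: positions.induct) (auto simp: Suc_diff_le)

text \<open>The next symbol is \<open>OmS\<close> exactly when the list starts with the current m,
  because after a variable all entries exceed m (the fact \<open>no\<close>). Once the list is
  exhausted, the number of variables fixes the remaining block.\<close>

lemma positions_inj:
  fixes w w' :: "unit symbol list"
  assumes "positions m w = positions m w'" and "vars w = vars w'"
  shows "w = w'"
proof -
  have no: "positions (Suc m) v \<noteq> m # xs" for m xs and v :: "unit symbol list"
    using positions_ge[of m "Suc m" v] by auto
  show ?thesis
    using assms
  proof (induction m w arbitrary: w' rule: positions.induct)
    case (1 m)
    then have "oms w' = 0" "vars w' = 0"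
      by (metis length_positions list.size(3) positions.simps(1), simp)
    then show ?case
      by (cases w') (auto split: if_splits)
  next
    case (2 m w)
    then show ?case
      by (cases "(m, w')" rule: positions.cases) (auto simp: no no[symmetric])
  next
    case (3 m v w)
    then show ?case
      by (cases "(m, w')" rule: positions.cases) (auto simp: no no[symmetric])
  qed
qed

lemma last_entries_eq_iff:
  assumes "length xs = n" and "length ys = n" and "k \<le> n"
  shows "(\<forall>i\<in>{n - k + 1..n}. xs ! (i - 1) = ys ! (i - 1)) \<longleftrightarrow> drop (n - k) xs = drop (n - k) ys"
    (is "?L \<longleftrightarrow> ?R")
proof
  assume L: ?L
  show ?R
  proof (rule nth_equalityI)
    fix i assume "i < length (drop (n - k) xs)"
    then have "n - k + i < n"
      using assms by simp
    then show "drop (n - k) xs ! i = drop (n - k) ys ! i"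
      using L[rule_format, of "Suc (n - k + i)"] assms by simp
  qed (use assms in simp)
next
  assume R: ?R
  show ?L
  proof
    fix i assume i: "i \<in> {n - k + 1..n}"
    then have "drop (n - k) xs ! (i - 1 - (n - k)) = drop (n - k) ys ! (i - 1 - (n - k))"
      using R by simp
    then show "xs ! (i - 1) = ys ! (i - 1)"
      using i assms by auto
  qed
qed

section \<open>The relation as a kernel\<close>

text \<open>One condition covers both cases of \<open>Sig\<close>: for n < k trimming is the
  identity and \<open>prefix\<close> is injective; for n >= k the trimmed word carries the same
  information as the last k entries.\<close>

lemma Sig_iff:
  assumes "p \<ge> 2"
  shows "(s, t) \<in> Sig p k \<longleftrightarrow>
    s \<in> bracketings p \<and> t \<in> bracketings p \<and> trim k (prefix s) = trim k (prefix t)"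
proof -
  have key: "(if n < k then s = t
      else \<forall>i\<in>{n - k + 1..n}. IT s ! (i - 1) = IT t ! (i - 1)) \<longleftrightarrow>
      trim k (prefix s) = trim k (prefix t)" if "s \<in> B p n" "t \<in> B p n" for n
  proof (cases "n < k")
    case True
    then show ?thesis
      using that inj_on_prefix[of p] by (auto simp: B_def om_count_def trim_ident inj_on_def)
  next
    case False
    have "(\<forall>i\<in>{n - k + 1..n}. IT s ! (i - 1) = IT t ! (i - 1)) \<longleftrightarrow>
        drop (n - k) (IT s) = drop (n - k) (IT t)"
      using that False by (intro last_entries_eq_iff) (auto simp: IT_positions B_def om_count_def)
    also have "\<dots> \<longleftrightarrow> positions 1 (trim k (prefix s)) = positions 1 (trim k (prefix t))"
      using that by (simp add: positions_trim IT_positions B_def om_count_def)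
    also have "\<dots> \<longleftrightarrow> trim k (prefix s) = trim k (prefix t)"
      using that assms positions_inj[of 1 "trim k (prefix s)" "trim k (prefix t)"]
      by (auto simp: vars_trim oms_vars_prefix B_def om_count_def)
    finally show ?thesis
      using False by simp
  qed
  \<comment> \<open>This lets the common size n be dropped: trimming keeps the variables, and since
    p - 1 > 0 their number determines the number of operation symbols.\<close>
  have cnt: "om_count s = om_count t"
    if "s \<in> bracketings p" "t \<in> bracketings p" "trim k (prefix s) = trim k (prefix t)"
  proof -
    have "vars (prefix s) = vars (prefix t)"
      using that(3) vars_trim by metis
    then show ?thesis
      using that assms by (simp add: om_count_def oms_vars_prefix)
  qed
  have "(s, t) \<in> Sig p k \<longleftrightarrow>
      (\<exists>n. s \<in> B p n \<and> t \<in> B p n \<and> trim k (prefix s) = trim k (prefix t))"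
    unfolding Sig_def mem_Collect_eq prod.case by (intro ex_cong1 conj_cong refl, rule key)
  also have "\<dots> \<longleftrightarrow> s \<in> bracketings p \<and> t \<in> bracketings p \<and> trim k (prefix s) = trim k (prefix t)"
    unfolding B_def mem_Collect_eq using cnt by blast
  finally show ?thesis .
qed

lemma equiv_Sig:
  assumes "p \<ge> 2"
  shows "equiv (bracketings p) (Sig p k)"
  by (rule equivI) (auto simp: refl_on_def sym_def trans_def Sig_iff[OF assms])

lemma level_Sig:
  assumes "p \<ge> 2"
  shows "level p n (Sig p k) =
    {(s, t) \<in> B p n \<times> B p n. trim k (prefix s) = trim k (prefix t)}"
  by (auto simp: level_def Sig_iff[OF assms] B_def)

section \<open>The maps \<open>gam\<close> and \<open>bet\<close> on prefix words, and closure under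
  implication\<close>

lemma gam_B:
  assumes "i \<in> {1..p}" and "t \<in> B p n"
  shows "gam p i t \<in> B p (n + 1)"
    and "prefix (gam p i t) =
      OmS # replicate (i - 1) (VarS ()) @ prefix t @ replicate (p - i) (VarS ())"
proof -
  have c: "concat (map prefix (replicate j vx)) = replicate j (VarS ())" for j
    by (induction j) auto
  have "(replicate p vx)[i - 1 := t] = replicate (i - 1) vx @ t # replicate (p - i) vx"
    using assms(1) by (auto simp: upd_conv_take_nth_drop min_def)
  then show *: "prefix (gam p i t) =
      OmS # replicate (i - 1) (VarS ()) @ prefix t @ replicate (p - i) (VarS ())"
    by (simp add: gam_def c)
  have "gam p i t \<in> bracketings p"
  proof -
    have "set ((replicate p vx)[i - 1 := t]) \<subseteq> {t, vx}"
      using set_update_subset_insert[of "replicate p vx" "i - 1" t] by auto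
    moreover have "{t, vx} \<subseteq> bracketings p"
      using assms(2) by (auto simp: B_def intro: bracketings.intros)
    ultimately show ?thesis
      unfolding gam_def by (intro bracketings.intros) auto
  qed
  then show "gam p i t \<in> B p (n + 1)"
    using assms(2) by (simp add: B_def om_count_def *)
qed

lemma subst_label_bracketings:
  "t \<in> bracketings p \<Longrightarrow> \<forall>v. \<theta> v \<in> bracketings p \<Longrightarrow> subst \<theta> (label m t) \<in> bracketings p"
proof (induction arbitrary: m rule: bracketings.induct)
  case (2 ts)
  have "length (labels m ts) = length ts \<and>
      (\<forall>u\<in>set (labels m ts). subst \<theta> u \<in> bracketings p)" for m
    using 2(2,3) by (induction ts arbitrary: m) auto
  then show ?case
    using 2(1) by (auto intro!: bracketings.intros)
qed simp

lemma bet_B: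
  assumes "i \<in> {1..(p - 1) * n + 1}" and "t \<in> B p n" and "p \<ge> 1"
  shows "bet p i t \<in> B p (n + 1)"
proof -
  let ?\<phi> = "prefix \<circ> (\<lambda>j. if j = i then Om (replicate p vx) else vx)"
  have br: "bet p i t \<in> bracketings p"
    unfolding bet_def eps1_def using assms(2)
    by (intro subst_label_bracketings) (auto simp: B_def intro!: bracketings.intros)
  have c: "oms (concat (map prefix (replicate j vx))) = 0" for j
    by (induction j) auto
  \<comment> \<open>The start m is kept general for the induction; number i occurs exactly in the
    stated range, which for m = 1 is the allowed range of i.\<close>
  have "oms (word_subst ?\<phi> (relabel m w)) = oms w + (if m \<le> i \<and> i < m + vars w then 1 else 0)"
    for m and w :: "unit symbol list"
    by (induction m w rule: relabel.induct) (auto simp: c)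
  then show ?thesis
    using br assms oms_vars_prefix[of t p]
    by (auto simp: B_def om_count_def bet_def prefix_subst eps1_def prefix_label)
qed

lemma closed_Sig:
  assumes "p \<ge> 2"
  shows "closed_under_impl p (Sig p k)"
  unfolding closed_under_impl_def
proof
  fix n
  let ?R = "level p (n + 1) (Sig p k)"
  let ?U = "\<Union>\<xi> \<in> gam p ` {1..p} \<union> bet p ` {1..(p - 1) * n + 1}.
    {(\<xi> s, \<xi> t) | s t. (s, t) \<in> level p n (Sig p k)}"
  have g: "(gam p i s, gam p i t) \<in> ?R"
    if "i \<in> {1..p}" "(s, t) \<in> level p n (Sig p k)" for i s t
  proof -
    have st: "s \<in> B p n" "t \<in> B p n" "trim k (prefix s) = trim k (prefix t)"
      using that by (auto simp: level_Sig[OF assms])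
    \<comment> \<open>\<open>gam\<close> merely puts fixed words around the prefix word.\<close>
    have "trim k ([OmS] @ replicate (i - 1) (VarS ()) @ prefix s @ replicate (p - i) (VarS ())) =
        trim k ([OmS] @ replicate (i - 1) (VarS ()) @ prefix t @ replicate (p - i) (VarS ()))"
      by (intro trim_append_cong st refl)
    then show ?thesis
      using gam_B[OF that(1) st(1)] gam_B[OF that(1) st(2)]
      by (simp add: level_Sig[OF assms] del: trim.simps)
  qed
  have b: "(bet p i s, bet p i t) \<in> ?R"
    if "i \<in> {1..(p - 1) * n + 1}" "(s, t) \<in> level p n (Sig p k)" for i s t
  proof -
    have st: "s \<in> B p n" "t \<in> B p n" "trim k (prefix s) = trim k (prefix t)"
      using that by (auto simp: level_Sig[OF assms])
    have "trim k (prefix (bet p i s)) = trim k (prefix (bet p i t))"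
      unfolding bet_def prefix_subst by (rule trim_subst_eps1_cong[OF st(3)])
    then show ?thesis
      using bet_B[OF that(1) st(1)] bet_B[OF that(1) st(2)] assms
      by (simp add: level_Sig[OF assms])
  qed
  have "?U \<subseteq> ?R"
    using g b by blast
  \<comment> \<open>A transitive relation containing the generating pairs contains their transitive
    closure.\<close>
  moreover have "trans ?R"
    unfolding level_Sig[OF assms] by (auto simp: trans_def)
  ultimately have "?U\<^sup>+ \<subseteq> ?R"
    using trancl_mono_subset[of ?U ?R] trancl_id[of ?R] by simp
  then show "impl_op p n (level p n (Sig p k)) \<subseteq> ?R"
    unfolding impl_op_def .
qed

section \<open>The groupoid\<close>

text \<open>Words are coded by natural numbers. As \<open>from_nat\<close> is total, every number
  denotes a word and the carrier is all of \<open>nat\<close>; arguments may thus denote untrimmed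
  words.\<close>

definition trim_op :: "nat \<Rightarrow> nat list \<Rightarrow> nat" where
  "trim_op k as = to_nat (trim k (OmS # concat (map from_nat as)) :: unit symbol list)"

lemma eval_trim_op_Om:
  "eval_trm (trim_op k) h (Om ts) =
    to_nat (trim k (OmS # concat (map (\<lambda>t. from_nat (eval_trm (trim_op k) h t)) ts))
      :: unit symbol list)"
proof -
  have "concat (map from_nat (map (eval_trm (trim_op k) h) ts)) =
      (concat (map (\<lambda>t. from_nat (eval_trm (trim_op k) h t)) ts) :: unit symbol list)"
    by (simp add: o_def)
  then show ?thesis
    by (simp only: eval_trm.simps trim_op_def[of k "map _ _"])
qed

text \<open>The outer \<open>trim\<close> on the left is needed because a variable may be assigned
  an untrimmed word; trims made inside the evaluation are absorbed by it.\<close>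

lemma trim_eval:
  "trim k (from_nat (eval_trm (trim_op k) h t) :: unit symbol list) =
    trim k (word_subst (from_nat \<circ> h) (prefix t))"
proof (induction t)
  case (Om ts)
  have "trim k ([OmS] @ concat (map (\<lambda>t. from_nat (eval_trm (trim_op k) h t)) ts)) =
      trim k ([OmS] @ concat (map (\<lambda>t. word_subst (from_nat \<circ> h) (prefix t)) ts)
        :: unit symbol list)"
    using Om by (intro trim_append_cong trim_concat_cong) (auto simp: o_def)
  moreover have "word_subst (from_nat \<circ> h) (prefix (Om ts)) =
      ([OmS] @ concat (map (\<lambda>t. word_subst (from_nat \<circ> h) (prefix t)) ts) :: unit symbol list)"
    by (simp add: word_subst_concat o_def)
  ultimately show ?case
    by (simp only: eval_trim_op_Om from_nat_to_nat trim_trim min.idem append_Cons append_Nil)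
qed simp

text \<open>For a compound term the value is already trimmed by its outermost operation, so the
  equation holds for the value itself.\<close>

lemma eval_trim_op_Om_word:
  "eval_trm (trim_op k) h (Om ts) =
    to_nat (trim k (word_subst (from_nat \<circ> h) (prefix (Om ts))) :: unit symbol list)"
  unfolding trim_eval[symmetric] eval_trim_op_Om by (simp add: trim_trim del: trim.simps)

lemma fine_spectrum_trim_op:
  assumes "p \<ge> 2" and "k \<ge> 1"
  shows "fine_spectrum p UNIV (trim_op k) = Sig p k"
proof (intro equalityI subrelI)
  fix s t
  assume "(s, t) \<in> fine_spectrum p UNIV (trim_op k)"
  then have st: "s \<in> bracketings p" "t \<in> bracketings p"
    and sat: "satisfies UNIV (trim_op k) (eps1 s) (eps1 t)"
    by (auto simp: fine_spectrum_def Lam_def)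
  \<comment> \<open>Sending every variable to the one-letter word erases the labels, so the value
    reveals the trimmed prefix word.\<close>
  let ?h = "\<lambda>_. to_nat [VarS ()] :: nat"
  have h: "word_subst (from_nat \<circ> ?h) (relabel m w) = w" for m and w :: "unit symbol list"
    by (induction m w rule: relabel.induct) auto
  have "eval_trm (trim_op k) ?h (eps1 s) = eval_trm (trim_op k) ?h (eps1 t)"
    using sat by (simp add: satisfies_def)
  then have "trim k (prefix s) = trim k (prefix t)"
    using trim_eval[of k ?h "eps1 s"] trim_eval[of k ?h "eps1 t"]
    by (simp only: eps1_def prefix_label h)
  then show "(s, t) \<in> Sig p k"
    using st Sig_iff[OF assms(1)] by blast
next
  fix s t
  assume S: "(s, t) \<in> Sig p k"
  then have st: "s \<in> bracketings p" "t \<in> bracketings p" "trim k (prefix s) = trim k (prefix t)"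
    using Sig_iff[OF assms(1)] by auto
  have "satisfies UNIV (trim_op k) (eps1 s) (eps1 t)"
    unfolding satisfies_def
  proof (intro allI impI)
    fix h
    have eq: "trim k (word_subst (from_nat \<circ> h) (prefix (eps1 s))) =
        trim k (word_subst (from_nat \<circ> h) (prefix (eps1 t)) :: unit symbol list)"
      by (rule trim_subst_eps1_cong[OF st(3)])
    \<comment> \<open>Since k >= 1, this minimum is 0 only for a variable, so both terms are
      variables or both are compound.\<close>
    have m: "min k (oms (prefix s)) = min k (oms (prefix t))"
      using st(3) oms_trim by metis
    show "eval_trm (trim_op k) h (eps1 s) = eval_trm (trim_op k) h (eps1 t)"
    proof (cases s)
      case (Var v)
      then obtain v' where "t = Var v'"
        using m assms(2) by (cases t) auto
      then show ?thesis
        using Var by simp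
    next
      case (Om ss)
      then obtain ts where "t = Om ts"
        using m assms(2) by (cases t) auto
      then show ?thesis
        using Om eq by (simp add: eps1_def eval_trim_op_Om_word del: eval_trm.simps prefix.simps)
    qed
  qed
  moreover have "(s, t) \<in> Lam p"
    using S by (auto simp: Sig_def Lam_def B_def)
  ultimately show "(s, t) \<in> fine_spectrum p UNIV (trim_op k)"
    by (simp add: fine_spectrum_def)
qed

section \<open>Counting\<close>

text \<open>The classes are the nonempty fibres of \<open>g\<close>, one for each value.\<close>

lemma card_quotient_kernel:
  "card (S // {(s, t) \<in> S \<times> S. g s = g t}) = card (g ` S)"
proof -
  have "{(s, t) \<in> S \<times> S. g s = g t} `` {x} = {y \<in> S. g y = g x}" if "x \<in> S" for x
    using that by auto
  then have "S // {(s, t) \<in> S \<times> S. g s = g t} = (\<lambda>c. {y \<in> S. g y = c}) ` g ` S"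
    unfolding quotient_def image_image by blast
  moreover have "inj_on (\<lambda>c. {y \<in> S. g y = c}) (g ` S)"
    by (auto simp: inj_on_def)
  ultimately show ?thesis
    by (simp add: card_image)
qed

section \<open>The number of bracketings\<close>

lemma finite_sum_list_eq: "finite {is :: nat list. length is = p \<and> sum_list is = n}"
  by (rule finite_subset[OF _ finite_lists_length_eq[of "{..n}" p]])
    (auto intro: member_le_sum_list)

lemma set_Cons_eq_image: "set_Cons A Xs = (\<lambda>(x, xs). x # xs) ` (A \<times> Xs)"
  by (auto simp: set_Cons_def)

lemma finite_listset: "\<forall>A\<in>set As. finite A \<Longrightarrow> finite (listset As)"
  by (induction As) (auto simp: set_Cons_eq_image)

lemma card_listset: "card (listset As) = prod_list (map card As)"
proof (induction As)
  case (Cons A As)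
  have "inj_on (\<lambda>(x, xs). x # xs) (A \<times> listset As)"
    by (auto simp: inj_on_def)
  then show ?case
    using Cons by (simp add: set_Cons_eq_image card_image card_cartesian_product)
qed simp

lemma in_listset_map:
  "xs \<in> listset (map A is) \<longleftrightarrow> list_all2 (\<lambda>x i. x \<in> A i) xs is"
  by (induction "is" arbitrary: xs) (auto simp: set_Cons_def list_all2_Cons2)

text \<open>Compound bracketings are sorted by the tuple of sizes of their arguments. Finiteness is
  carried through the induction because the disjoint union and its cardinality require it.\<close>

lemma card_B: "finite (B p n) \<and> card (B p n) = gen_catalan p n"
proof (induction n rule: less_induct)
  case (less n)
  show ?case
  proof (cases n)
    case 0
    have "B p 0 = {vx}"
    proof -
      have "t = vx" if "t \<in> bracketings p" "om_count t = 0" for t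
        using that by (cases t) (auto simp: om_count_def)
      moreover have "vx \<in> bracketings p"
        by (rule bracketings.intros)
      moreover have "om_count vx = 0"
        by (simp add: om_count_def)
      ultimately show ?thesis
        unfolding B_def by blast
    qed
    then show ?thesis
      using 0 by simp
  next
    case (Suc m)
    let ?I = "{is. length is = p \<and> sum_list is = m}"
    have oms_concat: "oms (concat (map prefix ts)) = sum_list (map om_count ts)"
      for ts :: "unit trm list"
      by (induction ts) (auto simp: om_count_def)
    \<comment> \<open>A list determines its size tuple, which gives both the decomposition of
      \<open>B p n\<close> and its disjointness.\<close>
    have mem: "ts \<in> listset (map (B p) is) \<longleftrightarrow> set ts \<subseteq> bracketings p \<and> map om_count ts = is"
      for ts "is"
      unfolding in_listset_map
    proof (induction ts arbitrary: "is")
      case (Cons t ts)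
      have "t \<in> B p i \<longleftrightarrow> t \<in> bracketings p \<and> om_count t = i" for i
        by (simp add: B_def)
      then show ?case
        using Cons by (cases "is") auto
    qed auto
    have "B p n = Om ` (\<Union>is\<in>?I. listset (map (B p) is))"
    proof (rule set_eqI)
      fix t
      show "t \<in> B p n \<longleftrightarrow> t \<in> Om ` (\<Union>is\<in>?I. listset (map (B p) is))"
      proof (cases t)
        case (Var v)
        then show ?thesis
          using Suc by (auto simp: B_def om_count_def)
      next
        case (Om ts)
        have "t \<in> bracketings p \<longleftrightarrow> length ts = p \<and> set ts \<subseteq> bracketings p"
          unfolding Om by (subst bracketings.simps) auto
        moreover have "om_count t = Suc (sum_list (map om_count ts))"
          unfolding Om oms_concat[symmetric] by (simp add: om_count_def)
        ultimately have "t \<in> B p n \<longleftrightarrow>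
            length ts = p \<and> set ts \<subseteq> bracketings p \<and> sum_list (map om_count ts) = m"
          using Suc by (auto simp: B_def)
        also have "\<dots> \<longleftrightarrow> ts \<in> (\<Union>is\<in>?I. listset (map (B p) is))"
          by (auto simp: mem)
        finally show ?thesis
          using Om by auto
      qed
    qed
    moreover have fin: "finite (listset (map (B p) is))"
      and crd: "card (listset (map (B p) is)) = prod_list (map (gen_catalan p) is)"
      if "is \<in> ?I" for "is"
    proof -
      have le: "\<forall>i\<in>set is. i < n"
        using that Suc by (auto simp: less_Suc_eq_le intro: member_le_sum_list)
      then show "finite (listset (map (B p) is))"
        using less by (intro finite_listset) auto
      show "card (listset (map (B p) is)) = prod_list (map (gen_catalan p) is)"
        using less le by (auto simp: card_listset intro!: arg_cong[of _ _ prod_list])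
    qed
    moreover have "card (\<Union>is\<in>?I. listset (map (B p) is)) =
        (\<Sum>is\<in>?I. card (listset (map (B p) is)))"
    proof (intro card_UN_disjoint ballI impI)
      fix "is" js :: "nat list"
      assume "is \<noteq> js"
      then show "listset (map (B p) is) \<inter> listset (map (B p) js) = {}"
        using mem[of _ "is"] mem[of _ js] by (intro equals0I) (metis IntE)
    qed (rule finite_sum_list_eq fin; assumption?)+
    moreover have "inj_on Om X" for X :: "unit trm list set"
      by (simp add: inj_on_def)
    ultimately show ?thesis
      using Suc finite_sum_list_eq by (simp add: card_image)
  qed
qed

section \<open>Ballot recursion for the trimmed words\<close>

definition good_words :: "nat \<Rightarrow> nat \<Rightarrow> nat \<Rightarrow> unit symbol list set" where
  "good_words q k m = {w. good q w \<and> oms w = k \<and> vars w = m}"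

lemma good_words_0: "good_words q 0 m = {replicate m (VarS ())}"
proof -
  have "w = replicate m (VarS ())" if "oms w = 0" "vars w = m" for w :: "unit symbol list" and m
    using that
  proof (induction w arbitrary: m)
    case (Cons a w)
    then show ?case
      by (cases a) auto
  qed simp
  moreover have "good q (replicate m (VarS ()))" "vars (replicate m (VarS ())) = m"
    by (induction m) auto
  ultimately show ?thesis
    unfolding good_words_def by auto
qed

text \<open>Such a word contains an \<open>OmS\<close>, hence is itself a nonempty suffix and would
  have to satisfy the strict inequality.\<close>

lemma good_words_empty: "m \<le> q * Suc k \<Longrightarrow> good_words q (Suc k) m = {}"
proof -
  assume m: "m \<le> q * Suc k"
  have "\<not> good q w" if "oms w = Suc k" "vars w = m" for w :: "unit symbol list"
    using that m by (cases w) (auto simp del: count_list.simps(2) filter.simps(2))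
  then show ?thesis
    by (auto simp: good_words_def)
qed

text \<open>The assumption is the suffix condition for the whole word; what remains concerns the
  word without its first letter.\<close>

lemma good_words_Suc:
  assumes "q * Suc k < Suc m"
  shows "good_words q (Suc k) (Suc m) =
    (#) (VarS ()) ` good_words q (Suc k) m \<union> (#) OmS ` good_words q k (Suc m)"
proof (rule set_eqI)
  fix w :: "unit symbol list"
  show "w \<in> good_words q (Suc k) (Suc m) \<longleftrightarrow>
    w \<in> (#) (VarS ()) ` good_words q (Suc k) m \<union> (#) OmS ` good_words q k (Suc m)"
  proof (cases w)
    case Nil
    then show ?thesis
      by (auto simp: good_words_def)
  next
    case (Cons a v)
    then show ?thesis
      using assms by (cases a) (auto simp: good_words_def image_iff)
  qed
qed

text \<open>This is the ballot number (m - q k) / (m + k) times the binomial coefficient of m + k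
  over k. The number m of variables is not tied to the form q n + 1, since the recursion lowers it
  by one. \<open>m \<ge> 1\<close> excludes the empty word, for which the formula gives 0.\<close>

lemma card_good_words:
  assumes "q \<ge> 1" and "m \<ge> 1" and "q * k \<le> m"
  shows "finite (good_words q k m) \<and>
    real (card (good_words q k m)) =
      (real m - real q * real k) * fact (m + k - 1) / (fact m * fact k)"
  using assms
proof (induction "m + k" arbitrary: k m rule: less_induct)
  case less
  show ?case
  proof (cases k)
    case 0
    then show ?thesis
      using less.prems fact_reduce[of m, where 'a = real]
      by (simp add: good_words_0)
  next
    case (Suc j)
    show ?thesis
    \<comment> \<open>On the boundary both sides vanish; above it both terms of the recursion stay
      within the induction hypothesis.\<close>
    proof (cases "m = q * k")
      case True
      then have "real m = real q * real k"
        by simp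
      then show ?thesis
        using True Suc good_words_empty[of m q j] by simp
    next
      case False
      then have lt: "q * k < m"
        using less.prems by simp
      \<comment> \<open>Together with \<open>lt\<close> this gives m >= 2, so m - 1 is still
        positive.\<close>
      moreover have "1 \<le> q * k"
        using less.prems Suc by simp
      ultimately obtain l where m: "m = Suc l" and l: "l \<ge> 1"
        by (cases m) auto
      have 1: "finite (good_words q (Suc j) l)"
        "real (card (good_words q (Suc j) l)) =
          (real l - real q * real (Suc j)) * fact (l + j) / (fact l * fact (Suc j))"
        using less.hyps[of l "Suc j"] lt l less.prems unfolding m Suc by auto
      have "q * j \<le> Suc l"
        using lt unfolding m Suc by simp
      then have 2: "finite (good_words q j (Suc l))"
        "real (card (good_words q j (Suc l))) =
          (real (Suc l) - real q * real j) * fact (l + j) / (fact (Suc l) * fact j)"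
        using less.hyps[of "Suc l" j] less.prems unfolding m Suc by auto
      have U: "good_words q k m =
          (#) (VarS ()) ` good_words q (Suc j) l \<union> (#) OmS ` good_words q j (Suc l)"
        using good_words_Suc[of q j l] lt unfolding m Suc by simp
      then have "card (good_words q k m) =
          card (good_words q (Suc j) l) + card (good_words q j (Suc l))"
        using 1(1) 2(1) by (subst U, subst card_Un_disjoint) (auto simp: card_image)
      then have "real (card (good_words q k m)) =
          (real l - real q * real (Suc j)) * fact (l + j) / (fact l * fact (Suc j)) +
          (real (Suc l) - real q * real j) * fact (l + j) / (fact (Suc l) * fact j)"
        using 1(2) 2(2) by simp
      also have "\<dots> = (real m - real q * real k) * fact (m + k - 1) / (fact m * fact k)"
      proof -
        \<comment> \<open>With A, D, F for the factorials of l, j, l + j, the recursion becomes an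
          identity of rational functions.\<close>
        have "(L - q * (J + 1)) * F / (A * ((J + 1) * D)) + (L + 1 - q * J) * F / ((L + 1) * A * D) =
            (L + 1 - q * (J + 1)) * ((L + J + 1) * F) / ((L + 1) * A * ((J + 1) * D))"
          if "A > 0" "D > 0" "L \<ge> 0" "J \<ge> 0" for A D F L J q :: real
        proof -
          have "L + 1 \<noteq> 0" "J + 1 \<noteq> 0"
            using that by auto
          then show ?thesis
            using that by (simp add: divide_simps) algebra
        qed
        from this[of "fact l" "fact j" "real l" "real j" "real q" "fact (l + j)"] show ?thesis
          unfolding m Suc by (simp add: algebra_simps)
      qed
      finally show ?thesis
        using U 1(1) 2(1) by simp
    qed
  qed
qed

lemma card_trim_prefix_image:
  assumes "p \<ge> 2" and "k \<le> n"
  shows "real (card ((\<lambda>t. trim k (prefix t)) ` B p n)) =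
    real ((p - 1) * (n - k) + 1) / real ((p - 1) * n + 1) * real (((p - 1) * n + k) choose k)"
proof -
  let ?M = "(p - 1) * n"
  have le: "(p - 1) * k \<le> ?M + 1"
    using assms(2) by (intro trans_le_add1 mult_le_mono2)
  \<comment> \<open>The ballot surplus m - q k for q = p - 1 and m = (p - 1) n + 1, written
    additively so that it transfers from naturals to reals.\<close>
  have "(p - 1) * (n - k) + 1 + (p - 1) * k = ?M + 1"
    using assms(2) by (simp add: diff_mult_distrib2)
  then have "real ((p - 1) * (n - k) + 1) + real (p - 1) * real k = real (?M + 1)"
    by (metis of_nat_add of_nat_mult)
  then have e: "real (?M + 1) - real (p - 1) * real k = real ((p - 1) * (n - k) + 1)"
    by linarith
  have "(\<lambda>t. trim k (prefix t)) ` B p n = good_words (p - 1) k (?M + 1)"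
    using trim_prefix_image[of p k n] assms by (simp add: good_words_def)
  moreover have "real (card (good_words (p - 1) k (?M + 1))) =
      (real (?M + 1) - real (p - 1) * real k) * fact (?M + 1 + k - 1) / (fact (?M + 1) * fact k)"
    using assms(1) by (intro card_good_words[THEN conjunct2] le) auto
  moreover have "?M + 1 + k - 1 = ?M + k"
    by simp
  ultimately have "real (card ((\<lambda>t. trim k (prefix t)) ` B p n)) =
      real ((p - 1) * (n - k) + 1) * fact (?M + k) / (fact (?M + 1) * fact k)"
    by (simp only: e)
  \<comment> \<open>Splitting off the top factor of \<open>fact (?M + 1)\<close> leaves the
    factorials of the binomial coefficient.\<close>
  also have "\<dots> = real ((p - 1) * (n - k) + 1) / real (?M + 1) * (fact (?M + k) / (fact k * fact ?M))"
    by (simp add: field_simps)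
  also have "fact (?M + k) / (fact k * fact ?M) = real ((?M + k) choose k)"
    by (simp add: binomial_fact)
  finally show ?thesis .
qed

lemma card_quotient_Sig:
  assumes "p \<ge> 2"
  shows "card (B p n // level p n (Sig p k)) = card ((\<lambda>t. trim k (prefix t)) ` B p n)"
  unfolding level_Sig[OF assms] by (rule card_quotient_kernel)

lemma card_trim_prefix_image_less:
  assumes "n < k"
  shows "card ((\<lambda>t. trim k (prefix t)) ` B p n) = gen_catalan p n"
proof -
  have "inj_on (\<lambda>t. trim k (prefix t)) (B p n)"
    using inj_on_prefix[of p] assms by (auto simp: inj_on_def B_def om_count_def trim_ident)
  then show ?thesis
    by (simp add: card_image card_B)
qed

theorem mainTheorem7:
  fixes p k :: nat
  assumes "p \<ge> 2" and "k \<ge> 1"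
  shows "equiv (bracketings p) (Sig p k)
    \<and> closed_under_impl p (Sig p k)
    \<and> (\<exists>(A :: nat set) f. p_groupoid p A f \<and> fine_spectrum p A f = Sig p k)
    \<and> (\<forall>(A :: 'a set) f. p_groupoid p A f \<and> fine_spectrum p A f = Sig p k \<longrightarrow>
        (\<forall>n. real (assoc_spectrum p A f n) =
          (if n < k then real (gen_catalan p n)
           else real ((p - 1) * (n - k) + 1) / real ((p - 1) * n + 1)
                  * real (((p - 1) * n + k) choose k))))"
proof (intro conjI allI impI)
  show "equiv (bracketings p) (Sig p k)"
    by (rule equiv_Sig[OF assms(1)])
  show "closed_under_impl p (Sig p k)"
    by (rule closed_Sig[OF assms(1)])
  have "p_groupoid p UNIV (trim_op k)"
    by (simp add: p_groupoid_def)
  then show "\<exists>(A :: nat set) f. p_groupoid p A f \<and> fine_spectrum p A f = Sig p k"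
    using fine_spectrum_trim_op[OF assms] by blast
next
  fix A :: "'a set" and f n
  assume "p_groupoid p A f \<and> fine_spectrum p A f = Sig p k"
  \<comment> \<open>The spectrum depends on the groupoid only through its fine spectrum, so the
    count applies to any carrier type.\<close>
  then have "assoc_spectrum p A f n = card ((\<lambda>t. trim k (prefix t)) ` B p n)"
    by (simp add: assoc_spectrum_def card_quotient_Sig[OF assms(1)])
  then show "real (assoc_spectrum p A f n) =
    (if n < k then real (gen_catalan p n)
     else real ((p - 1) * (n - k) + 1) / real ((p - 1) * n + 1)
            * real (((p - 1) * n + k) choose k))"
    using card_trim_prefix_image[OF assms(1), of k n] card_trim_prefix_image_less[of n k p]
    by (simp only: not_less split: if_split) (simp add: not_less)
qed

end
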